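(* Let $m,k\ge 1$ be integers and $0<\alpha<1$. Under the scaled Rayleigh model with prior $\pi_1(\sigma)\propto 1/\sigma$, the two-sided equi-tailed $100(1-\alpha)\%$ Bayesian prediction interval for $U_{m(k)}$ given $\mathbf{x}$, i.e. the interval $(L(\mathbf{x}),U(\mathbf{x}))$ with $$\Pr(U_{m(k)}>L(\mathbf{x})|\mathbf{x})=1-\frac{\alpha}{2}\quad\text{and}\quad \Pr(U_{m(k)}>U(\mathbf{x})|\mathbf{x})=\frac{\alpha}{2},$$ is $$\left(\sqrt{\frac{[1-\beta_{\frac{\alpha}{2}}(d,m)]\,\delta(\mathbf{x})}{k\,\beta_{\frac{\alpha}{2}}(d,m)}},\ \sqrt{\frac{[1-\beta_{1-\frac{\alpha}{2}}(d,m)]\,\delta(\mathbf{x})}{k\,\beta_{1-\frac{\alpha}{2}}(d,m)}}\right),$$ where $\delta(\mathbf{x})=\sum_{i=1}^d x_i^2+(n-d)T_0^2$ and $\beta_\gamma(n_1,n_2)$ denotes the upper $\gamma$-th quantile of the $Beta(n_1,n_2)$ distribution, i.e. $P(V>\beta_\gamma(n_1,n_2))=\gamma$ for $V\sim Beta(n_1,n_2)$.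
   Context: Model. $n$ iid component lifetimes have density $f(x;\sigma)=\frac{x}{\sigma}\exp\{-x^2/(2\sigma)\}$, $x>0$ (scaled Rayleigh distribution, $\sigma>0$ unknown). They are observed under Type-I hybrid censoring with pre-fixed integer $1\le r\le n$ and time $T>0$: the test stops at $T_0=\min\{x_{r:n},T\}$, where $x_{1:n}<\cdots<x_{n:n}$ are the ordered lifetimes; $d=\max\{s: s\le r,\ x_{s:n}\le T\}$, assumed to satisfy $d\ge 1$; and the observed sample is $\mathbf{x}=(x_1,\ldots,x_d)=(x_{1:n},\ldots,x_{d:n})$. Thus $0<x_1<\cdots<x_d\le T_0$, and $T_0=x_d$ if $d=r$ while $T_0=T$ if $d<r$. The likelihood is $$L(\sigma|\mathbf{x})\propto \sigma^{-d}\Big[\prod_{i=1}^d x_i\Big]\exp\Big\{-\frac{1}{2\sigma}\Big[\sum_{i=1}^d x_i^2+(n-d)T_0^2\Big]\Big\}.$$ Posterior. $\pi_1^*(\sigma|\mathbf{x})$ is the probability density on $(0,\infty)$ proportional to $L(\sigma|\mathbf{x})\cdot\frac1\sigma$. Repair times. $U_{m(k)}$ is the $m$-th minimal repair time of a series system of $k$ independent identical components with the same lifetime distribution, independent of the sample given $\sigma$; its density given $\sigma$ is $$f_{U_{m(k)}}(u|\sigma)=\frac{k^m u^{2m-1}}{\Gamma(m)\sigma^m 2^{m-1}}\exp\Big\{-\frac{k u^2}{2\sigma}\Big\},\qquad u>0.$$ $\Pr(\cdot|\mathbf{x})$ refers to the predictive distribution with density $f^*_{U_{m(k)}}(u|\mathbf{x})=\int_0^\infty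 f_{U_{m(k)}}(u|\sigma)\pi_1^*(\sigma|\mathbf{x})\,d\sigma$. *)

theory Defs
  imports "HOL-Probability.Probability" "HOL-Real_Asymp.Real_Asymp"
begin

definition distribution_of :: "(real \<Rightarrow> real) \<Rightarrow> real measure" where
  "distribution_of f = density lborel (\<lambda>x. ennreal (f x))"

definition rayleigh_density :: "real \<Rightarrow> real \<Rightarrow> real" where
  "rayleigh_density \<sigma> x = (if x > 0 then x / \<sigma> * exp (- x\<^sup>2 / (2 * \<sigma>)) else 0)"

definition order_stat :: "real list \<Rightarrow> nat \<Rightarrow> real" where
  "order_stat w i = sort w ! (i - 1)"

text \<open>The element \<open>0\<close> is inserted so that the maximum is \<open>0\<close> when no failure occurs by time \<open>T\<close>.\<close>

definition hybrid_failures :: "nat \<Rightarrow> real \<Rightarrow> real list \<Rightarrow> nat" where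
  "hybrid_failures r T w = Max (insert 0 {s \<in> {1..r}. order_stat w s \<le> T})"

definition hybrid_stop_time :: "nat \<Rightarrow> real \<Rightarrow> real list \<Rightarrow> real" where
  "hybrid_stop_time r T w = min (order_stat w r) T"

text \<open>Joint density of the \<open>d\<close> observed failures \<open>x 1 < \<dots> < x d\<close> among \<open>n\<close> iid lifetimes with
  density \<open>f\<close>, the other \<open>n - d\<close> lifetimes being censored at time \<open>t\<close>.\<close>

definition censored_likelihood ::
  "(real \<Rightarrow> real) \<Rightarrow> nat \<Rightarrow> nat \<Rightarrow> real \<Rightarrow> (nat \<Rightarrow> real) \<Rightarrow> real" where
  "censored_likelihood f n d t x =
     fact n / fact (n - d) * (\<Prod>i=1..d. f (x i)) * measure (distribution_of f) {t<..} ^ (n - d)"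

definition rayleigh_likelihood :: "nat \<Rightarrow> nat \<Rightarrow> real \<Rightarrow> (nat \<Rightarrow> real) \<Rightarrow> real \<Rightarrow> real" where
  "rayleigh_likelihood n d t x \<sigma> = censored_likelihood (rayleigh_density \<sigma>) n d t x"

definition posterior_density :: "(real \<Rightarrow> real) \<Rightarrow> (real \<Rightarrow> real) \<Rightarrow> real \<Rightarrow> real" where
  "posterior_density lik prior \<sigma> =
     (if \<sigma> > 0 then lik \<sigma> * prior \<sigma> / (LBINT s:{0<..}. lik s * prior s) else 0)"

definition repair_density :: "nat \<Rightarrow> nat \<Rightarrow> real \<Rightarrow> real \<Rightarrow> real" where
  "repair_density m k \<sigma> u =
     (if u > 0
      then real k ^ m * u ^ (2 * m - 1) / (Gamma (real m) * \<sigma> ^ m * 2 ^ (m - 1))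
             * exp (- (real k * u\<^sup>2) / (2 * \<sigma>))
      else 0)"

definition predictive_density :: "(real \<Rightarrow> real \<Rightarrow> real) \<Rightarrow> (real \<Rightarrow> real) \<Rightarrow> real \<Rightarrow> real" where
  "predictive_density f post u = (LBINT \<sigma>:{0<..}. f \<sigma> u * post \<sigma>)"

definition repair_predictive ::
  "nat \<Rightarrow> nat \<Rightarrow> nat \<Rightarrow> nat \<Rightarrow> real \<Rightarrow> (nat \<Rightarrow> real) \<Rightarrow> real measure" where
  "repair_predictive m k n d t x =
     distribution_of (predictive_density (repair_density m k)
       (posterior_density (rayleigh_likelihood n d t x) (\<lambda>\<sigma>. 1 / \<sigma>)))"

definition equi_tailed_interval :: "real measure \<Rightarrow> real \<Rightarrow> real \<Rightarrow> real \<Rightarrow> bool" where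
  "equi_tailed_interval M \<alpha> l u \<longleftrightarrow>
     measure M {l<..} = 1 - \<alpha> / 2 \<and> measure M {u<..} = \<alpha> / 2"

definition beta_density :: "real \<Rightarrow> real \<Rightarrow> real \<Rightarrow> real" where
  "beta_density a b v =
     (if 0 < v \<and> v < 1 then v powr (a - 1) * (1 - v) powr (b - 1) / Beta a b else 0)"

text \<open>For \<open>a, b > 0\<close> and \<open>0 < \<gamma> < 1\<close> the point is unique, the density being positive on \<open>(0, 1)\<close>.\<close>

definition beta_upper_quantile :: "real \<Rightarrow> real \<Rightarrow> real \<Rightarrow> real" where
  "beta_upper_quantile \<gamma> a b = (THE q. measure (distribution_of (beta_density a b)) {q<..} = \<gamma>)"

definition delta_stat :: "nat \<Rightarrow> nat \<Rightarrow> real \<Rightarrow> (nat \<Rightarrow> real) \<Rightarrow> real" where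
  "delta_stat n d t x = (\<Sum>i=1..d. (x i)\<^sup>2) + real (n - d) * t\<^sup>2"

lemma rayleigh_survival:
  assumes "\<sigma> > 0" "t \<ge> 0"
  shows "measure (distribution_of (rayleigh_density \<sigma>)) {t<..} = exp (- t\<^sup>2 / (2 * \<sigma>))"
proof -
  let ?F = "\<lambda>x. - exp (- x\<^sup>2 / (2 * \<sigma>))"
  let ?f = "\<lambda>x. x / \<sigma> * exp (- x\<^sup>2 / (2 * \<sigma>))"
  have [measurable]: "rayleigh_density \<sigma> \<in> borel_measurable borel"
    unfolding rayleigh_density_def by measurable
  have "emeasure (distribution_of (rayleigh_density \<sigma>)) {t<..} =
      (\<integral>\<^sup>+x. ennreal (rayleigh_density \<sigma> x) * indicator {t<..} x \<partial>lborel)"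
    unfolding distribution_of_def by (subst emeasure_density) auto
  also have "\<dots> = (\<integral>\<^sup>+x. ennreal (?f x) * indicator {t..} x \<partial>lborel)"
    using assms AE_lborel_singleton[of t]
    by (intro nn_integral_cong_AE)
       (auto elim!: eventually_mono simp: rayleigh_density_def indicator_def)
  also have "\<dots> = ennreal (0 - ?F t)"
  proof (rule nn_integral_FTC_atLeast)
    show "DERIV ?F x :> ?f x" for x
      using assms by (auto intro!: derivative_eq_intros simp: field_simps)
    show "0 \<le> ?f x" if "t \<le> x" for x
      using assms that by simp
    have "filterlim (\<lambda>x::real. x\<^sup>2 / (2 * \<sigma>)) at_top at_top"
      using assms by real_asymp
    then have "((\<lambda>x. exp (- (x\<^sup>2 / (2 * \<sigma>)))) \<longlongrightarrow> 0) at_top"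
      by (intro filterlim_compose[OF exp_at_bot] filterlim_compose[OF filterlim_uminus_at_bot_at_top])
    then show "(?F \<longlongrightarrow> 0) at_top"
      using tendsto_minus by fastforce
  qed auto
  finally show ?thesis
    by (simp add: measure_def)
qed

text \<open>Consistency check: the likelihood in its usual form
  \<open>\<sigma>\<^sup>-\<^sup>d (\<Prod> x\<^sub>i) exp (- \<delta>(x) / (2 \<sigma>))\<close>, up to a factor that does not depend on \<open>\<sigma>\<close>.\<close>

lemma rayleigh_likelihood_eq:
  assumes "\<sigma> > 0" "t \<ge> 0" "\<And>i. i \<in> {1..d} \<Longrightarrow> x i > 0"
  shows "rayleigh_likelihood n d t x \<sigma> =
    fact n / fact (n - d) *
      (1 / \<sigma> ^ d * (\<Prod>i=1..d. x i) * exp (- 1 / (2 * \<sigma>) * delta_stat n d t x))"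
proof -
  have "(\<Prod>i=1..d. rayleigh_density \<sigma> (x i)) =
      (\<Prod>i=1..d. x i * (1 / \<sigma>) * exp (- (x i)\<^sup>2 / (2 * \<sigma>)))"
    using assms(3) by (intro prod.cong) (auto simp: rayleigh_density_def)
  also have "\<dots> = (\<Prod>i=1..d. x i) * (1 / \<sigma>) ^ d * exp (\<Sum>i=1..d. - (x i)\<^sup>2 / (2 * \<sigma>))"
    by (simp only: prod.distrib prod_constant exp_sum finite_atLeastAtMost card_atLeastAtMost) simp
  finally have P: "(\<Prod>i=1..d. rayleigh_density \<sigma> (x i)) = \<dots>" .
  have E: "exp (- 1 / (2 * \<sigma>) * delta_stat n d t x) =
      exp (\<Sum>i=1..d. - (x i)\<^sup>2 / (2 * \<sigma>)) * exp (- t\<^sup>2 / (2 * \<sigma>)) ^ (n - d)"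
    by (simp add: delta_stat_def flip: exp_of_nat_mult exp_add)
       (simp add: sum_negf sum_divide_distrib[symmetric] add_divide_distrib diff_divide_distrib)
  show ?thesis
    unfolding rayleigh_likelihood_def censored_likelihood_def rayleigh_survival[OF assms(1,2)] P E
    by (simp add: power_one_over field_simps)
qed

end

theory Submission
  imports Defs
begin

text \<open>
  Given the data, the parameter \<open>\<sigma>\<close> has an inverse gamma posterior with shape \<open>d\<close>
  and scale \<open>\<delta> / 2\<close> (\<open>posterior_density_rayleigh\<close>). The repair density has the matching form in
  \<open>\<sigma>\<close>, so the mixture can be integrated in closed form (\<open>predictive_density_rayleigh\<close>): the
  predictive density is
  \<open>2 k\<^sup>m u\<^sup>2\<^sup>m\<^sup>-\<^sup>1 \<delta>\<^sup>d / (B(d, m) (\<delta> + k u\<^sup>2)\<^sup>d\<^sup>+\<^sup>m)\<close>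
  for \<open>u > 0\<close>. Substituting \<open>V = \<delta> / (\<delta> + k U\<^sup>2)\<close> turns it into the Beta\<open>(d, m)\<close> density
  (\<open>emeasure_beta_odds_atMost\<close>).

  Because \<open>V\<close> decreases in \<open>U\<close>, the upper tail of \<open>U\<close> beyond \<open>c \<ge> 0\<close> has probability \<open>1 - \<gamma>\<close> if and
  only if the upper tail of \<open>V\<close> beyond \<open>\<delta> / (\<delta> + k c\<^sup>2)\<close> has probability \<open>\<gamma>\<close>. The beta
  distribution has exactly one such point (\<open>beta_upper_quantile\<close>), and solving for \<open>c\<close> gives the
  stated end points, with \<open>\<gamma> = \<alpha> / 2\<close> for the left and \<open>\<gamma> = 1 - \<alpha> / 2\<close> for the right one
  (\<open>beta_odds_tail_eq_iff\<close>). The uniqueness of the quantile is what makes the theorem an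
  equivalence.
\<close>

section \<open>Posterior and predictive density\<close>

text \<open>Integration by parts lowers the exponent of \<open>1 / s\<close> by one: \<open>exp (- c / s)\<close> has the
  derivative \<open>c exp (- c / s) / s\<^sup>2\<close>, so that with \<open>A\<^sub>p\<close> for the antiderivative at \<open>p\<close>,
  \<open>A\<^sub>p\<^sub>+\<^sub>1(s) = exp (- c / s) / (c s\<^sup>p\<^sup>+\<^sup>1) + (p + 1) / c A\<^sub>p(s)\<close>. The boundary term vanishes
  at both ends, and the limit at infinity picks up a factor \<open>(p + 1) / c\<close> in each step.\<close>

lemma inverse_gamma_antiderivative:
  fixes c :: real assumes "c > 0"
  shows "\<exists>A. (\<forall>s>0. (A has_real_derivative exp (- c / s) / s ^ (p + 2)) (at s)) \<and>
    (A \<longlongrightarrow> 0) (at_right 0) \<and> (A \<longlongrightarrow> fact p / c ^ Suc p) at_top"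
proof (induction p)
  case 0
  have "((\<lambda>s. exp (- c / s) / c) \<longlongrightarrow> 0) (at_right 0)" "((\<lambda>s. exp (- c / s) / c) \<longlongrightarrow> inverse c) at_top"
    using assms by real_asymp+
  moreover have "((\<lambda>s. exp (- c / s) / c) has_real_derivative exp (- c / s) / s ^ 2) (at s)" if "s > 0" for s
    using that assms by (auto intro!: derivative_eq_intros simp: power2_eq_square)
  ultimately show ?case
    by (intro exI[of _ "\<lambda>s. exp (- c / s) / c"]) (auto simp: numeral_2_eq_2 inverse_eq_divide)
next
  case (Suc p)
  then obtain A where A: "\<And>s. s > 0 \<Longrightarrow> (A has_real_derivative exp (- c / s) / s ^ (p + 2)) (at s)"
    "(A \<longlongrightarrow> 0) (at_right 0)" "(A \<longlongrightarrow> fact p / c ^ Suc p) at_top" by auto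
  let ?h = "\<lambda>s. exp (- c / s) / (c * s ^ Suc p)"
  let ?B = "\<lambda>s. ?h s + real (Suc p) / c * A s"
  have h: "(?h \<longlongrightarrow> 0) (at_right 0)" "(?h \<longlongrightarrow> 0) at_top"
    using assms by real_asymp+
  have "(?B \<longlongrightarrow> 0) (at_right 0)"
    using tendsto_add[OF h(1) tendsto_mult[OF tendsto_const A(2)], of "real (Suc p) / c"] by simp
  moreover have "(?B \<longlongrightarrow> fact (Suc p) / c ^ Suc (Suc p)) at_top"
    using tendsto_add[OF h(2) tendsto_mult[OF tendsto_const A(3)], of "real (Suc p) / c"] by simp
  moreover have "(?B has_real_derivative exp (- c / s) / s ^ (Suc p + 2)) (at s)" if s: "s > 0" for s
  proof -
    have "(?h has_real_derivative
        (exp (- c / s) * (c / s\<^sup>2) * (c * s ^ Suc p) - exp (- c / s) * (c * (real (Suc p) * s ^ p))) /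
          ((c * s ^ Suc p) * (c * s ^ Suc p))) (at s)"
      using s assms
      by (auto intro!: derivative_eq_intros simp: power2_eq_square simp del: power_Suc)
    from DERIV_add[OF this DERIV_cmult[OF A(1)[OF s], of "real (Suc p) / c"]]
    show ?thesis
      by (rule DERIV_cong) (use s assms in \<open>simp add: field_simps power2_eq_square\<close>)
  qed
  ultimately show ?case by blast
qed

text \<open>The normalizing constant of the inverse gamma distribution. It is used twice: for the
  posterior, and again for the mixture over \<open>\<sigma>\<close> that defines the predictive density.\<close>

lemma inverse_gamma_integral:
  fixes c :: real assumes "c > 0" "p > 0"
  shows "(LBINT s:{0<..}. exp (- c / s) / s ^ Suc p) = Gamma (real p) / c ^ p"
proof -
  obtain q where q: "p = Suc q" using assms(2) gr0_implies_Suc by blast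
  obtain A where A: "\<And>s. s > 0 \<Longrightarrow> (A has_real_derivative exp (- c / s) / s ^ (q + 2)) (at s)"
    "(A \<longlongrightarrow> 0) (at_right 0)" "(A \<longlongrightarrow> fact q / c ^ Suc q) at_top"
    using inverse_gamma_antiderivative[OF assms(1)] by blast
  have 1: "((A \<circ> real_of_ereal) \<longlongrightarrow> 0) (at_right 0)"
    using A(2) unfolding zero_ereal_def by (simp add: ereal_tendsto_simps)
  have 2: "((A \<circ> real_of_ereal) \<longlongrightarrow> fact q / c ^ Suc q) (at_left \<infinity>)"
    using A(3) by (simp add: ereal_tendsto_simps)
  have "(LBINT s=0..\<infinity>. exp (- c / s) / s ^ (q + 2)) = fact q / c ^ Suc q - 0"
  proof (rule interval_integral_FTC_nonneg(2)[OF _ _ _ _ 1 2])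
    show "(A has_real_derivative exp (- c / s) / s ^ (q + 2)) (at s)" if "0 < ereal s" for s
      using that by (intro A(1)) simp
    show "isCont (\<lambda>s. exp (- c / s) / s ^ (q + 2)) s" if "0 < ereal s" for s
      using that by (intro continuous_intros) auto
  qed (auto intro!: AE_I2)
  moreover have "einterval 0 \<infinity> = {0<..}"
    by (simp add: zero_ereal_def)
  ultimately show ?thesis
    by (simp add: interval_lebesgue_integral_def q Gamma_fact[of q, where 'a = real, simplified]
       add.commute[of _ 1])
qed

text \<open>The likelihood depends on the data through \<open>\<delta>\<close> and \<open>d\<close> only, up to a factor free of
  \<open>\<sigma>\<close> that cancels in the normalization; what remains is an inverse gamma density with shape
  \<open>d\<close> and scale \<open>\<delta> / 2\<close>.\<close>

lemma posterior_density_rayleigh: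
  assumes "t \<ge> 0" "\<And>i. i \<in> {1..d} \<Longrightarrow> x i > 0" "d > 0" "delta_stat n d t x > 0" "s > 0"
  shows "posterior_density (rayleigh_likelihood n d t x) (\<lambda>\<sigma>. 1 / \<sigma>) s =
    (delta_stat n d t x / 2) ^ d / Gamma (real d) *
      (exp (- (delta_stat n d t x / 2) / s) / s ^ Suc d)"
proof -
  define c where "c = delta_stat n d t x / 2"
  define K where "K = fact n / fact (n - d) * (\<Prod>i=1..d. x i)"
  have c: "c > 0" using assms by (simp add: c_def)
  have K: "K > 0" unfolding K_def using assms(2) by (auto intro!: mult_pos_pos prod_pos divide_pos_pos)
  have L: "rayleigh_likelihood n d t x \<sigma> * (1 / \<sigma>) = K * (exp (- c / \<sigma>) / \<sigma> ^ Suc d)" if "\<sigma> > 0" for \<sigma>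
  proof -
    have "- 1 / (2 * \<sigma>) * delta_stat n d t x = - c / \<sigma>" by (simp add: c_def)
    then show ?thesis
      by (simp only: rayleigh_likelihood_eq[OF that assms(1,2)]) (simp add: K_def mult_ac)
  qed
  have "(LBINT s:{0<..}. rayleigh_likelihood n d t x s * (1 / s)) =
      (LBINT s:{0<..}. K * (exp (- c / s) / s ^ Suc d))"
    by (rule set_lebesgue_integral_cong) (use L in auto)
  also have "\<dots> = K * (Gamma (real d) / c ^ d)"
    by (simp only: set_integral_mult_right inverse_gamma_integral[OF c \<open>d > 0\<close>])
  finally have "posterior_density (rayleigh_likelihood n d t x) (\<lambda>\<sigma>. 1 / \<sigma>) s =
      K * (exp (- c / s) / s ^ Suc d) / (K * (Gamma (real d) / c ^ d))"
    using \<open>s > 0\<close> L[OF \<open>s > 0\<close>] by (simp add: posterior_density_def)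
  also have "\<dots> = c ^ d / Gamma (real d) * (exp (- c / s) / s ^ Suc d)"
    using K by (simp add: mult_ac)
  finally show ?thesis by (simp add: c_def)
qed

text \<open>Conjugacy: given \<open>\<sigma>\<close>, the density at \<open>u\<close> contributes \<open>exp (- k u\<^sup>2 / (2 \<sigma>)) / \<sigma>\<^sup>m\<close>, which
  turns the posterior into an unnormalized inverse gamma density of shape \<open>d + m\<close> and scale
  \<open>(\<delta> + k u\<^sup>2) / 2\<close>.\<close>

lemma predictive_density_rayleigh:
  fixes n d :: nat and t :: real and x :: "nat \<Rightarrow> real"
  defines "\<delta> \<equiv> delta_stat n d t x"
  assumes "t \<ge> 0" "\<And>i. i \<in> {1..d} \<Longrightarrow> x i > 0" "d > 0" "m > 0" "\<delta> > 0" "u \<ge> 0"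
  shows "predictive_density (repair_density m k)
      (posterior_density (rayleigh_likelihood n d t x) (\<lambda>\<sigma>. 1 / \<sigma>)) u =
    2 * real k ^ m * u ^ (2 * m - 1) * \<delta> ^ d / (Beta (real d) (real m) * (\<delta> + real k * u\<^sup>2) ^ (d + m))"
proof (cases "u = 0")
  case True
  then show ?thesis using \<open>m > 0\<close>
    by (simp add: predictive_density_def repair_density_def)
next
  case False
  with \<open>u \<ge> 0\<close> have u: "u > 0" by simp
  define R where "R = real k ^ m * u ^ (2 * m - 1) / (Gamma (real m) * 2 ^ (m - 1))"
  define c where "c = (\<delta> + real k * u\<^sup>2) / 2"
  have c: "c > 0" using \<open>\<delta> > 0\<close> by (simp add: c_def add_pos_nonneg)
  have "predictive_density (repair_density m k)
      (posterior_density (rayleigh_likelihood n d t x) (\<lambda>\<sigma>. 1 / \<sigma>)) u =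
      (LBINT s:{0<..}. R * (\<delta> / 2) ^ d / Gamma (real d) * (exp (- c / s) / s ^ Suc (d + m)))"
    unfolding predictive_density_def
  proof (rule set_lebesgue_integral_cong)
    show "\<forall>s. s \<in> {0<..} \<longrightarrow> repair_density m k s u *
        posterior_density (rayleigh_likelihood n d t x) (\<lambda>\<sigma>. 1 / \<sigma>) s =
        R * (\<delta> / 2) ^ d / Gamma (real d) * (exp (- c / s) / s ^ Suc (d + m))"
    proof (intro allI impI)
      fix s :: real assume "s \<in> {0<..}"
      then have s: "s > 0" by simp
      have e: "exp (- c / s) = exp (- (real k * u\<^sup>2) / (2 * s)) * exp (- (\<delta> / 2) / s)"
      proof -
        have "- c / s = - (real k * u\<^sup>2) / (2 * s) + - (\<delta> / 2) / s"
          using s by (simp add: c_def field_simps)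
        then show ?thesis by (simp only: exp_add)
      qed
      have post: "posterior_density (rayleigh_likelihood n d t x) (\<lambda>\<sigma>. 1 / \<sigma>) s =
          (\<delta> / 2) ^ d / Gamma (real d) * (exp (- (\<delta> / 2) / s) / s ^ Suc d)"
        unfolding \<delta>_def
        by (rule posterior_density_rayleigh[where x = x, OF assms(2,3,4) assms(6)[unfolded \<delta>_def] s])
      show "repair_density m k s u *
        posterior_density (rayleigh_likelihood n d t x) (\<lambda>\<sigma>. 1 / \<sigma>) s =
        R * (\<delta> / 2) ^ d / Gamma (real d) * (exp (- c / s) / s ^ Suc (d + m))"
        unfolding e post repair_density_def R_def power_Suc power_add if_P[OF u]
        by (simp add: field_simps)
    qed
  qed simp
  also have "\<dots> = R * (\<delta> / 2) ^ d / Gamma (real d) * (Gamma (real (d + m)) / c ^ (d + m))"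
    by (subst set_integral_mult_right, subst inverse_gamma_integral) (use c \<open>d > 0\<close> in auto)
  also have "\<dots> = 2 * real k ^ m * u ^ (2 * m - 1) * \<delta> ^ d /
      (Beta (real d) (real m) * (\<delta> + real k * u\<^sup>2) ^ (d + m))"
  proof -
    have G: "Gamma (real d) \<noteq> 0" "Gamma (real m) \<noteq> 0" "Gamma (real d + real m) \<noteq> 0"
      using \<open>d > 0\<close> \<open>m > 0\<close> by (auto intro!: less_imp_neq[OF Gamma_real_pos, symmetric])
    have "\<delta> + real k * u\<^sup>2 > 0" using c by (simp add: c_def)
    then have p: "(\<delta> + real k * u\<^sup>2) ^ (d + m) \<noteq> 0" by simp
    obtain j where "m = Suc j" using \<open>m > 0\<close> gr0_implies_Suc by blast
    then have "(2 :: real) ^ (d + m) = 2 * 2 ^ d * 2 ^ (m - 1)" by (simp add: power_add)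
    then have c_pow: "c ^ (d + m) = (\<delta> + real k * u\<^sup>2) ^ (d + m) / (2 * 2 ^ d * 2 ^ (m - 1))"
      unfolding c_def power_divide by (rule arg_cong)
    \<comment> \<open>The powers and Gamma values are abstracted to variables, as only cancellation remains.\<close>
    have "K * U / (Gm * P) * (D / Q) / Gd * (G / (S / (2 * Q * P))) = 2 * K * U * D / (Gd * Gm / G * S)"
      if "Gm \<noteq> 0" "Gd \<noteq> 0" "G \<noteq> 0" "P \<noteq> 0" "Q \<noteq> 0" "S \<noteq> 0" for K U Gm P D Q Gd G S :: real
      using that by (simp add: field_simps)
    from this[OF G(2,1,3) _ _ p, of "2 ^ (m - 1)" "2 ^ d"] show ?thesis
      unfolding R_def c_pow Beta_def power_divide[of \<delta>] of_nat_add by simp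
  qed
  finally show ?thesis .
qed

section \<open>Quantiles of the beta distribution\<close>

lemma beta_density_measurable [measurable]: "beta_density a b \<in> borel_measurable borel"
  unfolding beta_density_def[abs_def] by measurable

lemma emeasure_distribution_of:
  assumes "f \<in> borel_measurable borel" "A \<in> sets borel"
  shows "emeasure (distribution_of f) A = (\<integral>\<^sup>+x. ennreal (f x) * indicator A x \<partial>lborel)"
  using assms by (simp add: distribution_of_def emeasure_density)

lemma beta_real_distribution:
  assumes "a > 0" "b > 0"
  shows "real_distribution (distribution_of (beta_density a b))"
proof -
  have B: "Beta a b > 0" using assms by (auto simp: Beta_def)
  have "((\<lambda>t. t powr (a - 1) * (1 - t) powr (b - 1) / Beta a b) has_integral 1) {0..1}"
    using has_integral_divide[OF has_integral_Beta_real[OF assms], of "Beta a b"] B by simp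
  then have "(\<integral>\<^sup>+t. ennreal (t powr (a - 1) * (1 - t) powr (b - 1) / Beta a b) * indicator {0..1} t \<partial>lborel) = 1"
    by (subst nn_integral_has_integral_lebesgue') (use B in auto)
  also have "(\<integral>\<^sup>+t. ennreal (t powr (a - 1) * (1 - t) powr (b - 1) / Beta a b) * indicator {0..1} t \<partial>lborel) =
     (\<integral>\<^sup>+t. ennreal (beta_density a b t) * indicator UNIV t \<partial>lborel)"
    using AE_lborel_singleton[of 0] AE_lborel_singleton[of 1]
    by (intro nn_integral_cong_AE, eventually_elim)
       (auto simp: beta_density_def indicator_def)
  finally have "prob_space (distribution_of (beta_density a b))"
    by (intro prob_spaceI) (simp add: distribution_of_def emeasure_density)
  then show ?thesis
    by (simp add: real_distribution_def real_distribution_axioms_def distribution_of_def)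
qed

text \<open>The density is positive on \<open>(0, 1)\<close>; this is what makes quantiles unique.\<close>

lemma beta_distribution_Ioc_pos:
  assumes "a > 0" "b > 0" "0 \<le> p" "p < q" "q \<le> 1"
  shows "measure (distribution_of (beta_density a b)) {p<..q} > 0"
proof -
  interpret real_distribution "distribution_of (beta_density a b)"
    by (rule beta_real_distribution) fact+
  have B: "Beta a b > 0" using assms by (auto simp: Beta_def)
  have "emeasure (distribution_of (beta_density a b)) {p<..q} \<noteq> 0"
  proof
    assume "emeasure (distribution_of (beta_density a b)) {p<..q} = 0"
    then have "AE v in lborel. ennreal (beta_density a b v) * indicator {p<..q} v = 0"
      by (subst (asm) emeasure_distribution_of) (simp_all add: nn_integral_0_iff_AE)
    then have "AE v in lborel. v \<notin> {p<..<q}"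
      by eventually_elim (use assms B in \<open>auto simp: beta_density_def indicator_def split: if_splits\<close>)
    then have "emeasure lborel {p<..<q} = 0"
      by (subst (asm) AE_iff_measurable[of "{p<..<q}"]) auto
    then show False using assms by simp
  qed
  then show ?thesis by (simp add: emeasure_eq_measure zero_less_measure_iff)
qed

lemma beta_tail_strict:
  assumes "a > 0" "b > 0" "0 \<le> p" "p < q" "q \<le> 1"
  shows "measure (distribution_of (beta_density a b)) {q<..} < measure (distribution_of (beta_density a b)) {p<..}"
proof -
  interpret real_distribution "distribution_of (beta_density a b)"
    by (rule beta_real_distribution) fact+
  have "{p<..q} \<union> {q<..} = {p<..}" using assms by auto
  then have "prob {p<..} = prob {p<..q} + prob {q<..}"
    using finite_measure_Union[of "{p<..q}" "{q<..}"] by (simp add: disjoint_iff)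
  then show ?thesis using beta_distribution_Ioc_pos[OF assms] by simp
qed

lemma beta_tail_0: 
  assumes "a > 0" "b > 0" "p \<le> 0"
  shows "measure (distribution_of (beta_density a b)) {p<..} = 1"
proof -
  interpret real_distribution "distribution_of (beta_density a b)"
    by (rule beta_real_distribution) fact+
  have "emeasure (distribution_of (beta_density a b)) {..p} = (\<integral>\<^sup>+v. 0 \<partial>(lborel :: real measure))"
    by (subst emeasure_distribution_of, simp, simp, intro nn_integral_cong)
       (use assms in \<open>auto simp: beta_density_def indicator_def\<close>)
  then have "prob {..p} = 0" by (simp add: measure_def)
  moreover have "UNIV - {..p} = {p<..}" by auto
  then have "prob {p<..} = 1 - prob {..p}"
    using prob_compl[of "{..p}"] by simp
  ultimately show ?thesis by simp
qed

lemma beta_tail_1: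
  assumes "a > 0" "b > 0" "p \<ge> 1"
  shows "measure (distribution_of (beta_density a b)) {p<..} = 0"
proof -
  have "emeasure (distribution_of (beta_density a b)) {p<..} = (\<integral>\<^sup>+v. 0 \<partial>(lborel :: real measure))"
    by (subst emeasure_distribution_of, simp, simp, intro nn_integral_cong)
       (use assms in \<open>auto simp: beta_density_def indicator_def\<close>)
  then show ?thesis by (simp add: measure_def)
qed

lemma beta_tail_continuous:
  assumes "a > 0" "b > 0"
  shows "isCont (\<lambda>q. measure (distribution_of (beta_density a b)) {q<..}) p"
proof -
  interpret real_distribution "distribution_of (beta_density a b)"
    by (rule beta_real_distribution) fact+
  have "emeasure (distribution_of (beta_density a b)) {p} = 0"
    by (subst emeasure_distribution_of) (auto simp: nn_integral_indicator_singleton)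
  then have "isCont (cdf (distribution_of (beta_density a b))) p"
    by (simp add: isCont_cdf measure_def)
  moreover have "prob {q<..} = 1 - cdf (distribution_of (beta_density a b)) q" for q
  proof -
    have "UNIV - {..q} = {q<..}" by auto
    then show ?thesis using prob_compl[of "{..q}"] by (simp add: cdf_def)
  qed
  ultimately show ?thesis by simp
qed

text \<open>The upper tail function is continuous, falls strictly on \<open>[0, 1]\<close> and is constantly \<open>1\<close> to the
  left and \<open>0\<close> to the right of that interval, hence it takes each level in \<open>(0, 1)\<close> exactly
  once. So the definite description is well defined.\<close>

lemma beta_upper_quantile:
  assumes "a > 0" "b > 0" "0 < \<gamma>" "\<gamma> < 1"
  shows "0 < beta_upper_quantile \<gamma> a b" "beta_upper_quantile \<gamma> a b < 1"
    and "measure (distribution_of (beta_density a b)) {q<..} = \<gamma> \<longleftrightarrow> q = beta_upper_quantile \<gamma> a b"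
proof -
  let ?G = "\<lambda>q. measure (distribution_of (beta_density a b)) {q<..}"
  have "\<exists>q. 0 \<le> q \<and> q \<le> 1 \<and> ?G q = \<gamma>"
    by (rule IVT2) (use assms in \<open>simp_all add: beta_tail_0 beta_tail_1 beta_tail_continuous\<close>)
  then obtain q where q: "?G q = \<gamma>" by blast
  have range: "0 < p \<and> p < 1" if "?G p = \<gamma>" for p
  proof (intro conjI; rule ccontr)
    show False if "\<not> 0 < p" using beta_tail_0[OF assms(1,2), of p] \<open>?G p = \<gamma>\<close> that \<open>\<gamma> < 1\<close> by simp
    show False if "\<not> p < 1" using beta_tail_1[OF assms(1,2), of p] \<open>?G p = \<gamma>\<close> that \<open>0 < \<gamma>\<close> by simp
  qed
  have unique: "p = q" if "?G p = \<gamma>" for p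
  proof (rule linorder_cases[of p q])
    assume "p < q"
    then show ?thesis using beta_tail_strict[OF assms(1,2), of p q] range[OF that] range[OF q] that q by simp
  next
    assume "q < p"
    then show ?thesis using beta_tail_strict[OF assms(1,2), of q p] range[OF that] range[OF q] that q by simp
  qed
  have eq: "beta_upper_quantile \<gamma> a b = q"
    unfolding beta_upper_quantile_def
  proof (rule the_equality)
    show "?G q = \<gamma>" by (rule q)
    show "p = q" if "?G p = \<gamma>" for p using that by (rule unique)
  qed
  show "0 < beta_upper_quantile \<gamma> a b" "beta_upper_quantile \<gamma> a b < 1"
    unfolding eq using range[OF q] by simp_all
  show "?G p = \<gamma> \<longleftrightarrow> p = beta_upper_quantile \<gamma> a b" for p
    unfolding eq using unique q by blast
qed

section \<open>From the beta distribution to the predictive distribution\<close>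

text \<open>The density of \<open>sqrt (\<delta> / \<kappa> * (1 - V) / V)\<close> for \<open>V\<close> with the distribution Beta\<open>(d, m)\<close>, that is,
  of the root of a scaled beta prime variable.\<close>

definition beta_odds_density :: "real \<Rightarrow> real \<Rightarrow> nat \<Rightarrow> nat \<Rightarrow> real \<Rightarrow> real" where
  "beta_odds_density \<delta> \<kappa> d m u = (if u < 0 then 0 else
     2 * \<kappa> ^ m * u ^ (2 * m - 1) * \<delta> ^ d / (Beta (real d) (real m) * (\<delta> + \<kappa> * u\<^sup>2) ^ (d + m)))"

lemma beta_odds_density_measurable [measurable]:
  "beta_odds_density \<delta> \<kappa> d m \<in> borel_measurable borel"
  unfolding beta_odds_density_def[abs_def] by measurable

text \<open>The factor on the right is the derivative of \<open>\<kappa> u\<^sup>2 / (\<delta> + \<kappa> u\<^sup>2)\<close>, so this is the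
  integrand identity behind the substitution \<open>1 - V = \<kappa> U\<^sup>2 / (\<delta> + \<kappa> U\<^sup>2)\<close>.\<close>

lemma beta_odds_density_eq:
  assumes "\<delta> > 0" "\<kappa> > 0" "d > 0" "m > 0" "u \<ge> 0"
  shows "beta_odds_density \<delta> \<kappa> d m u =
    beta_density (real d) (real m) (1 - \<kappa> * u\<^sup>2 / (\<delta> + \<kappa> * u\<^sup>2)) * (2 * \<kappa> * u * \<delta> / (\<delta> + \<kappa> * u\<^sup>2)\<^sup>2)"
proof (cases "u = 0")
  case True
  then show ?thesis using \<open>m > 0\<close> by (simp add: beta_odds_density_def)
next
  case False
  with \<open>u \<ge> 0\<close> have u: "u > 0" "\<not> u < 0" by simp_all
  define S where "S = \<delta> + \<kappa> * u\<^sup>2"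
  have S: "S > 0" "\<delta> < S" using assms u by (simp_all add: S_def add_pos_pos)
  have v: "1 - \<kappa> * u\<^sup>2 / S = \<delta> / S" using S(1) by (simp add: S_def field_simps)
  have v': "1 - \<delta> / S = \<kappa> * u\<^sup>2 / S" using v by simp
  obtain a b where ab: "d = Suc a" "m = Suc b"
    using \<open>d > 0\<close> \<open>m > 0\<close> gr0_implies_Suc by metis
  have B: "beta_density (real d) (real m) (\<delta> / S) = (\<delta> / S) ^ a * (\<kappa> * u\<^sup>2 / S) ^ b / Beta (real d) (real m)"
    unfolding beta_density_def v' using S u assms by (simp add: ab powr_realpow)
  have u': "u ^ (2 * m - 1) = (u\<^sup>2) ^ b * u"
    by (simp add: ab power_mult[symmetric])
  have S': "S ^ (d + m) = S ^ a * S ^ b * S\<^sup>2"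
    by (simp add: ab power_add power2_eq_square)
  \<comment> \<open>The powers are abstracted to variables, which leaves an identity of fractions.\<close>
  have "2 * (\<kappa> * K) * (U * u) * (\<delta> * D) / (Be * (A * B * S\<^sup>2)) = (D / A) * (K * U / B) / Be * (2 * \<kappa> * u * \<delta> / S\<^sup>2)"
    for K U D Be A B by (simp add: mult_ac)
  from this[of "\<kappa> ^ b" "(u\<^sup>2) ^ b" "\<delta> ^ a" "Beta (real d) (real m)" "S ^ a" "S ^ b"] show ?thesis
    unfolding beta_odds_density_def if_not_P[OF u(2)] S_def[symmetric] v B u' S'
      power_divide power_mult_distrib
    by (simp only: ab power_Suc)
qed

text \<open>The event \<open>U \<le> c\<close> corresponds to \<open>V \<ge> \<delta> / (\<delta> + \<kappa> c\<^sup>2)\<close>. The substitution is made in terms of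
  \<open>1 - V\<close>, which increases with \<open>U\<close>, and on \<open>[0, c]\<close>, so that only compact intervals occur;
  \<open>V\<close> may be taken strictly larger because a single point is a null set.\<close>

lemma emeasure_beta_odds_atMost:
  assumes "\<delta> > 0" "\<kappa> > 0" "d > 0" "m > 0" "c \<ge> 0"
  shows "emeasure (distribution_of (beta_odds_density \<delta> \<kappa> d m)) {..c} =
    emeasure (distribution_of (beta_density (real d) (real m))) {\<delta> / (\<delta> + \<kappa> * c\<^sup>2)<..}"
proof -
  let ?b = "beta_density (real d) (real m)"
  let ?q = "\<delta> / (\<delta> + \<kappa> * c\<^sup>2)"
  define g where "g = (\<lambda>u. \<kappa> * u\<^sup>2 / (\<delta> + \<kappa> * u\<^sup>2))"
  define g' where "g' = (\<lambda>u. 2 * \<kappa> * u * \<delta> / (\<delta> + \<kappa> * u\<^sup>2)\<^sup>2)"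
  have pos: "\<delta> + \<kappa> * u\<^sup>2 > 0" for u using assms by (simp add: add_pos_nonneg)
  have g0: "g 0 = 0" by (simp add: g_def)
  have gc: "g c = 1 - ?q" using pos[of c] by (simp add: g_def field_simps)
  have "emeasure (distribution_of ?b) {?q<..} = (\<integral>\<^sup>+v. ennreal (?b v) * indicator {?q<..} v \<partial>lborel)"
    by (rule emeasure_distribution_of) simp_all
  also have "\<dots> = (\<integral>\<^sup>+w. ennreal (?b (1 - w)) * indicator {?q<..} (1 - w) \<partial>lborel)"
    by (subst nn_integral_real_affine[where c = "-1" and t = 1]) simp_all
  also have "\<dots> = (\<integral>\<^sup>+w. ennreal (?b (1 - w) * indicator {g 0..g c} w) \<partial>lborel)"
    using AE_lborel_singleton[of "1 - ?q"]
    by (intro nn_integral_cong_AE, eventually_elim)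
       (auto simp: g0 gc beta_density_def indicator_def)
  also have "\<dots> = (\<integral>\<^sup>+u. ennreal (?b (1 - g u) * g' u * indicator {0..c} u) \<partial>lborel)"
  proof (rule nn_integral_substitution)
    show "set_borel_measurable borel {g 0..g c} (\<lambda>w. ?b (1 - w))"
      unfolding set_borel_measurable_def by measurable
    show "(g has_real_derivative g' u) (at u)" for u
      unfolding g_def g'_def using pos[of u]
      by (auto intro!: derivative_eq_intros simp: field_simps power2_eq_square)
    show "continuous_on {0..c} g'"
      unfolding g'_def using pos by (intro continuous_intros) (simp add: less_imp_neq[symmetric])
    show "g' u \<ge> 0" if "u \<in> {0..c}" for u
      using that assms by (simp add: g'_def)
  qed fact
  also have "\<dots> = (\<integral>\<^sup>+u. ennreal (beta_odds_density \<delta> \<kappa> d m u) * indicator {..c} u \<partial>lborel)"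
  proof (rule nn_integral_cong)
    fix u :: real
    show "ennreal (?b (1 - g u) * g' u * indicator {0..c} u) =
        ennreal (beta_odds_density \<delta> \<kappa> d m u) * indicator {..c} u"
    proof (cases "u < 0")
      case True
      then show ?thesis by (simp add: beta_odds_density_def)
    next
      case False
      then show ?thesis
        using beta_odds_density_eq[OF assms(1-4), of u] by (simp add: g_def g'_def indicator_def)
    qed
  qed
  also have "\<dots> = emeasure (distribution_of (beta_odds_density \<delta> \<kappa> d m)) {..c}"
    by (rule emeasure_distribution_of[symmetric]) simp_all
  finally show ?thesis by simp
qed

text \<open>Let \<open>c\<close> tend to infinity in the previous lemma: the bounds \<open>\<delta> / (\<delta> + \<kappa> c\<^sup>2)\<close> decrease to \<open>0\<close>,
  so the total mass equals that of the beta distribution on \<open>(0, \<infinity>)\<close>.\<close>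

lemma prob_space_beta_odds:
  assumes "\<delta> > 0" "\<kappa> > 0" "d > 0" "m > 0"
  shows "prob_space (distribution_of (beta_odds_density \<delta> \<kappa> d m))"
proof (rule prob_spaceI)
  let ?M = "distribution_of (beta_odds_density \<delta> \<kappa> d m)"
  let ?B = "distribution_of (beta_density (real d) (real m))"
  interpret B: real_distribution ?B
    by (rule beta_real_distribution) (use assms in auto)
  define q where "q = (\<lambda>i. \<delta> / (\<delta> + \<kappa> * (real i)\<^sup>2))"
  have pos: "\<delta> + \<kappa> * u\<^sup>2 > 0" for u using assms by (simp add: add_pos_nonneg)
  have sets: "sets ?M = sets borel" "space ?M = UNIV" by (simp_all add: distribution_of_def)
  have "q \<longlonglongrightarrow> 0" unfolding q_def using assms by real_asymp
  then have "\<exists>i. q i < v" if "v > 0" for v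
    using order_tendstoD(2)[of q 0 sequentially v] that by (auto simp: eventually_sequentially)
  moreover have "q i > 0" for i using pos assms by (simp add: q_def)
  ultimately have Uq: "(\<Union>i. {q i<..}) = {0<..}" by (auto intro: less_trans)
  have "(\<lambda>i. emeasure ?M {..real i}) \<longlonglongrightarrow> emeasure ?M (\<Union>i. {..real i})"
    by (rule Lim_emeasure_incseq) (auto simp: sets incseq_def)
  moreover have "(\<Union>i. {..real i}) = UNIV" using real_arch_simple by auto
  moreover have "(\<lambda>i. emeasure ?B {q i<..}) \<longlonglongrightarrow> emeasure ?B (\<Union>i. {q i<..})"
  proof (rule Lim_emeasure_incseq)
    have "q j \<le> q i" if "i \<le> j" for i j
      unfolding q_def using that assms pos
      by (intro divide_left_mono add_left_mono mult_left_mono power_mono) (auto intro!: mult_pos_pos)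
    then show "incseq (\<lambda>i. {q i<..})" by (fastforce simp: incseq_def)
  qed auto
  moreover have "emeasure ?M {..real i} = emeasure ?B {q i<..}" for i
    unfolding q_def by (rule emeasure_beta_odds_atMost) (use assms in auto)
  moreover have "emeasure ?B {0<..} = 1"
    using beta_tail_0[of "real d" "real m" 0] assms by (simp add: B.emeasure_eq_measure)
  ultimately show "emeasure ?M (space ?M) = 1"
    using LIMSEQ_unique by (auto simp: sets Uq)
qed

lemma beta_odds_tail:
  assumes "\<delta> > 0" "\<kappa> > 0" "d > 0" "m > 0" "c \<ge> 0"
  shows "measure (distribution_of (beta_odds_density \<delta> \<kappa> d m)) {c<..} =
    1 - measure (distribution_of (beta_density (real d) (real m))) {\<delta> / (\<delta> + \<kappa> * c\<^sup>2)<..}"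
proof -
  interpret prob_space "distribution_of (beta_odds_density \<delta> \<kappa> d m)"
    by (rule prob_space_beta_odds) fact+
  have "UNIV - {..c} = {c<..}" by auto
  then have "prob {c<..} = 1 - prob {..c}"
    using prob_compl[of "{..c}"] by (simp add: distribution_of_def)
  then show ?thesis
    using emeasure_beta_odds_atMost[OF assms] by (simp add: measure_def)
qed

text \<open>Upper quantiles of \<open>V\<close> become lower ones of \<open>U\<close>, since \<open>U\<close> decreases in \<open>V\<close>; solving
  \<open>\<delta> / (\<delta> + \<kappa> c\<^sup>2) = b\<close> for \<open>c \<ge> 0\<close> gives the root. A negative \<open>c\<close> has tail probability \<open>1\<close> and
  so never qualifies.\<close>

lemma beta_odds_tail_eq_iff:
  assumes "\<delta> > 0" "\<kappa> > 0" "d > 0" "m > 0" "0 < \<gamma>" "\<gamma> < 1"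
  defines "b \<equiv> beta_upper_quantile \<gamma> (real d) (real m)"
  shows "measure (distribution_of (beta_odds_density \<delta> \<kappa> d m)) {c<..} = 1 - \<gamma> \<longleftrightarrow>
    c = sqrt ((1 - b) * \<delta> / (\<kappa> * b))"
proof -
  let ?M = "distribution_of (beta_odds_density \<delta> \<kappa> d m)"
  interpret prob_space ?M
    by (rule prob_space_beta_odds) fact+
  have dm: "real d > 0" "real m > 0" using assms by auto
  have b: "0 < b" "b < 1"
    unfolding b_def using beta_upper_quantile(1,2)[OF dm \<open>0 < \<gamma>\<close> \<open>\<gamma> < 1\<close>] by auto
  have arg: "(1 - b) * \<delta> / (\<kappa> * b) \<ge> 0" using b assms(1,2) by simp
  show ?thesis
  proof (cases "c < 0")
    case True
    have "1 = prob {0<..}"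
      using beta_odds_tail[OF assms(1-4), of 0] beta_tail_1[OF dm, of 1] \<open>\<delta> > 0\<close> by simp
    also have "\<dots> \<le> prob {c<..}"
      using True by (intro finite_measure_mono) (auto simp: distribution_of_def)
    finally have "prob {c<..} \<noteq> 1 - \<gamma>" using \<open>0 < \<gamma>\<close> by simp
    moreover have "c \<noteq> sqrt ((1 - b) * \<delta> / (\<kappa> * b))"
      using True real_sqrt_ge_zero[OF arg] by linarith
    ultimately show ?thesis by simp
  next
    case False
    then have c: "c \<ge> 0" by simp
    have pos: "\<delta> + \<kappa> * c\<^sup>2 > 0" using assms(1,2) by (simp add: add_pos_nonneg)
    have "prob {c<..} = 1 - \<gamma> \<longleftrightarrow> \<delta> / (\<delta> + \<kappa> * c\<^sup>2) = b"
      unfolding beta_odds_tail[OF assms(1-4) c] b_def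
      using beta_upper_quantile(3)[OF dm \<open>0 < \<gamma>\<close> \<open>\<gamma> < 1\<close>, of "\<delta> / (\<delta> + \<kappa> * c\<^sup>2)"] by linarith
    also have "\<dots> \<longleftrightarrow> \<delta> = b * \<delta> + b * \<kappa> * c\<^sup>2"
      using pos by (simp add: field_simps)
    also have "\<dots> \<longleftrightarrow> c\<^sup>2 = (1 - b) * \<delta> / (\<kappa> * b)"
      using b(1) \<open>\<kappa> > 0\<close> by (auto simp: field_simps)
    also have "\<dots> \<longleftrightarrow> c = sqrt ((1 - b) * \<delta> / (\<kappa> * b))"
      using c arg by (metis real_sqrt_unique real_sqrt_pow2)
    finally show ?thesis .
  qed
qed

section \<open>The prediction interval\<close>

lemma delta_stat_pos:
  assumes "d > 0" "\<And>i. i \<in> {1..d} \<Longrightarrow> x i > 0"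
  shows "delta_stat n d t x > 0"
proof -
  have "(\<Sum>i=1..d. (x i)\<^sup>2) > 0"
    using assms by (intro sum_pos zero_less_power) auto
  then show ?thesis unfolding delta_stat_def by (intro add_pos_nonneg) simp_all
qed

lemma repair_predictive_eq:
  assumes "t \<ge> 0" "\<And>i. i \<in> {1..d} \<Longrightarrow> x i > 0" "d > 0" "m > 0"
  shows "repair_predictive m k n d t x =
    distribution_of (beta_odds_density (delta_stat n d t x) (real k) d m)"
proof -
  have "predictive_density (repair_density m k)
      (posterior_density (rayleigh_likelihood n d t x) (\<lambda>\<sigma>. 1 / \<sigma>)) u =
      beta_odds_density (delta_stat n d t x) (real k) d m u" for u
  proof (cases "u < 0")
    case True
    then show ?thesis
      by (simp add: predictive_density_def repair_density_def beta_odds_density_def)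
  next
    case False
    then have u: "u \<ge> 0" by simp
    show ?thesis
      using predictive_density_rayleigh[where x = x and n = n and k = k, OF assms delta_stat_pos[OF assms(3,2)] u] False
      by (simp add: beta_odds_density_def)
  qed
  then show ?thesis unfolding repair_predictive_def by presburger
qed

lemma order_stat_pos:
  assumes "\<forall>t\<in>set w. t > 0" "1 \<le> i" "i \<le> length w"
  shows "order_stat w i > 0"
proof -
  have "sort w ! (i - 1) \<in> set (sort w)" using assms(2,3) by (intro nth_mem) simp
  then show ?thesis using assms(1) by (simp add: order_stat_def)
qed

lemma hybrid_failures_le: "hybrid_failures r T w \<le> r"
  by (auto simp: hybrid_failures_def)

theorem mainTheorem2:
  fixes n r m k d :: nat
    and T T\<^sub>0 \<alpha> \<delta> l u :: real
    and w :: "real list"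
    and x :: "nat \<Rightarrow> real"
    and \<beta> :: "real \<Rightarrow> real"
  assumes "1 \<le> r" and "r \<le> n" and "T > 0"
    and "length w = n" and "distinct w" and "\<forall>t\<in>set w. t > 0"
    and "d = hybrid_failures r T w" and "d \<ge> 1"
    and "T\<^sub>0 = hybrid_stop_time r T w"
    and "\<forall>i\<in>{1..d}. x i = order_stat w i"
    and "m \<ge> 1" and "k \<ge> 1" and "0 < \<alpha>" and "\<alpha> < 1"
    and "\<delta> = delta_stat n d T\<^sub>0 x"
    and "\<beta> = (\<lambda>\<gamma>. beta_upper_quantile \<gamma> (real d) (real m))"
  shows "equi_tailed_interval (repair_predictive m k n d T\<^sub>0 x) \<alpha> l u \<longleftrightarrow>
           l = sqrt ((1 - \<beta> (\<alpha> / 2)) * \<delta> / (real k * \<beta> (\<alpha> / 2))) \<and>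
           u = sqrt ((1 - \<beta> (1 - \<alpha> / 2)) * \<delta> / (real k * \<beta> (1 - \<alpha> / 2)))"
proof -
  \<comment> \<open>Beyond the length of \<open>w\<close> an order statistic would be an unspecified list entry.\<close>
  have "d \<le> n" using hybrid_failures_le[of r T w] assms(2,7) by simp
  then have x: "x i > 0" if "i \<in> {1..d}" for i
    using that order_stat_pos[of w i] assms(4,6,10) by simp
  have T0: "T\<^sub>0 \<ge> 0"
    using order_stat_pos[of w r] assms(1-4,6,9) by (simp add: hybrid_stop_time_def)
  have dm: "d > 0" "m > 0" "real k > 0" using assms(8,11,12) by simp_all
  have \<delta>: "\<delta> > 0" unfolding assms(15) by (rule delta_stat_pos[OF dm(1) x])
  have M: "repair_predictive m k n d T\<^sub>0 x = distribution_of (beta_odds_density \<delta> (real k) d m)"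
    unfolding assms(15) by (rule repair_predictive_eq[OF T0 x dm(1,2)])
  have "measure (repair_predictive m k n d T\<^sub>0 x) {l<..} = 1 - \<alpha> / 2 \<longleftrightarrow>
      l = sqrt ((1 - \<beta> (\<alpha> / 2)) * \<delta> / (real k * \<beta> (\<alpha> / 2)))"
    unfolding M assms(16) by (rule beta_odds_tail_eq_iff[OF \<delta> dm(3,1,2)]) (use assms(13,14) in auto)
  moreover have "measure (repair_predictive m k n d T\<^sub>0 x) {u<..} = 1 - (1 - \<alpha> / 2) \<longleftrightarrow>
      u = sqrt ((1 - \<beta> (1 - \<alpha> / 2)) * \<delta> / (real k * \<beta> (1 - \<alpha> / 2)))"
    unfolding M assms(16) by (rule beta_odds_tail_eq_iff[OF \<delta> dm(3,1,2)]) (use assms(13,14) in auto)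
  ultimately show ?thesis
    unfolding equi_tailed_interval_def by simp
qed

end
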